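(* Consider the two-stage pricing game described in the context, under complete information and perfect price discrimination (the utility may choose a separate unit price $p_i$ for each user). Then the profit-maximizing solution $\mathbf p^\ast$ of the first stage is $$\mathbf p^\ast=\frac{\mathbf a}{2}+CZ\frac{\mathbf a}{2}-W^\top\Gamma Z\frac{\mathbf a}{4}+\Gamma WZ\frac{\mathbf a}{4},\qquad Z=\Big[2\Gamma+B+C-\Big(\frac{W^\top\Gamma}{2}+\frac{\Gamma W}{2}\Big)\Big]^{-1}.$$ The optimal consumption under this policy is $$\mathbf x^\ast=\Big(C+B+2\Gamma-\frac{W^\top\Gamma}{2}-\frac{\Gamma W}{2}\Big)^{-1}\frac{\mathbf a}{2}.$$ For the special case of symmetric networks, i.e. $W=W^\top$, the optimal profit is $$\Pi^\ast=\frac14\,\mathbf a^\top(C+B+2\Gamma-\Gamma W)^{-1}\mathbf a.$$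
   Context: Model. Users are $\mathcal I=\{1,\dots,n\}$; $W=(w_{ij})\in\mathbb R^{n\times n}$ has entries in $[0,1]$, zero diagonal and all row sums equal to $1$. User $i$ has parameters $a_i$, $b_i$, $\gamma_i\ge0$, pays unit price $p_i$, and consumes $x_i\ge 0$ to maximize $u_i=a_ix_i-b_ix_i^2-p_ix_i+\gamma_ix_i(\sum_jw_{ij}x_j-x_i)$. Standing assumption: $a_i>p_i$ and $b_i>\gamma_i$ for all $i$. Notation: $\mathbf a=(a_1,\dots,a_n)^\top$, $B=\mathrm{diag}(2b_1,\dots,2b_n)$ (note the factor 2), $\Gamma=\mathrm{diag}(\gamma_1,\dots,\gamma_n)$, $C=\mathrm{diag}(c_1,\dots,c_n)$, where $c_i\ge0$ are cost parameters. Second stage: given the price vector $\mathbf p$, users consume according to the unique Nash equilibrium $\mathbf x(\mathbf p)=(B+2\Gamma-\Gamma W)^{-1}(\mathbf a-\mathbf p)$. First stage: the utility, knowing all parameters, chooses $\mathbf p^\ast=\arg\max_{\mathbf p\ge\mathbf 0}\Pi$, where $\Pi=\sum_{i\in\mathcal I}(p_ix_i-c_ix_i^2)=\mathbf p^\top\mathbf x-\mathbf x^\top C\mathbf x$ with $\mathbf x=\mathbf x(\mathbf p)$. The optimal consumption is $\mathbf x^\ast=\mathbf x(\mathbf p^\ast)$ and $\Pi^\ast$ is the resulting profit.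
   Formalization: The formulas are proved when the matrix inverted in Z is positive definite and the formula's price is ≥ 0 (and for every unique optimum with all prices positive); for W=Wᵀ the displayed profit needs ΓW=WΓ, otherwise ¼aᵀZa is proved, since the claim fails as stated. *)

theory Defs
  imports "HOL-Analysis.Analysis"
begin

text \<open>
  The users are the elements of a finite type \<open>'n\<close>; parameters, prices and consumptions are
  vectors of type \<open>real ^ 'n\<close>.
\<close>

definition diag :: "real ^ 'n \<Rightarrow> real ^ 'n ^ 'n" where
  "diag v = (\<chi> i j. if i = j then v $ i else 0)"

definition positive_definite :: "real ^ 'n ^ 'n \<Rightarrow> bool" where
  "positive_definite M \<longleftrightarrow> transpose M = M \<and> (\<forall>v. v \<noteq> 0 \<longrightarrow> 0 < v \<bullet> (M *v v))"

definition influence_matrix :: "real ^ 'n ^ 'n \<Rightarrow> bool" where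
  "influence_matrix W \<longleftrightarrow>
     (\<forall>i j. 0 \<le> W $ i $ j \<and> W $ i $ j \<le> 1) \<and> (\<forall>i. W $ i $ i = 0) \<and> (\<forall>i. (\<Sum>j\<in>UNIV. W $ i $ j) = 1)"

definition utility ::
    "real ^ 'n ^ 'n \<Rightarrow> real ^ 'n \<Rightarrow> real ^ 'n \<Rightarrow> real ^ 'n \<Rightarrow> real ^ 'n \<Rightarrow> 'n \<Rightarrow> real ^ 'n \<Rightarrow> real" where
  "utility W a b \<gamma> p i x =
     a $ i * x $ i - b $ i * (x $ i)\<^sup>2 - p $ i * x $ i
       + \<gamma> $ i * x $ i * ((\<Sum>j\<in>UNIV. W $ i $ j * x $ j) - x $ i)"

definition nash_equilibrium ::
    "real ^ 'n ^ 'n \<Rightarrow> real ^ 'n \<Rightarrow> real ^ 'n \<Rightarrow> real ^ 'n \<Rightarrow> real ^ 'n \<Rightarrow> real ^ 'n \<Rightarrow> bool" where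
  "nash_equilibrium W a b \<gamma> p x \<longleftrightarrow>
     (\<forall>i. 0 \<le> x $ i) \<and>
     (\<forall>i y. 0 \<le> y \<longrightarrow>
        utility W a b \<gamma> p i (\<chi> j. if j = i then y else x $ j) \<le> utility W a b \<gamma> p i x)"

text \<open>
  The second-stage response to the price vector \<open>p\<close>. Whenever \<open>p $ i < a $ i\<close> for all \<open>i\<close>, it is
  the unique Nash equilibrium at \<open>p\<close>; see \<open>nash_equilibrium_iff\<close> below.
\<close>

definition consumption ::
    "real ^ 'n ^ 'n \<Rightarrow> real ^ 'n \<Rightarrow> real ^ 'n \<Rightarrow> real ^ 'n \<Rightarrow> real ^ 'n \<Rightarrow> real ^ 'n" where
  "consumption W a b \<gamma> p = matrix_inv (diag (2 *\<^sub>R b) + 2 *\<^sub>R diag \<gamma> - diag \<gamma> ** W) *v (a - p)"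

definition profit ::
    "real ^ 'n ^ 'n \<Rightarrow> real ^ 'n \<Rightarrow> real ^ 'n \<Rightarrow> real ^ 'n \<Rightarrow> real ^ 'n \<Rightarrow> real ^ 'n \<Rightarrow> real" where
  "profit W a b \<gamma> c p =
     (let x = consumption W a b \<gamma> p in \<Sum>i\<in>UNIV. p $ i * x $ i - c $ i * (x $ i)\<^sup>2)"

text \<open>\<open>p\<close> is \<^emph>\<open>the\<close> (that is, the unique) maximizer of the profit over the nonnegative price vectors.\<close>

definition optimal_price ::
    "real ^ 'n ^ 'n \<Rightarrow> real ^ 'n \<Rightarrow> real ^ 'n \<Rightarrow> real ^ 'n \<Rightarrow> real ^ 'n \<Rightarrow> real ^ 'n \<Rightarrow> bool" where
  "optimal_price W a b \<gamma> c p \<longleftrightarrow>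
     {q. is_arg_max (profit W a b \<gamma> c) (\<lambda>q. \<forall>i. 0 \<le> q $ i) q} = {p}"

lemma response_matrix_nth:
  fixes x :: "real ^ 'n"
  shows "((diag (2 *\<^sub>R b) + 2 *\<^sub>R diag \<gamma> - diag \<gamma> ** W) *v x) $ i =
     2 * (b $ i + \<gamma> $ i) * x $ i - \<gamma> $ i * (\<Sum>j\<in>UNIV. W $ i $ j * x $ j)"
proof -
  have diag: "(diag v *v y) $ i = v $ i * y $ i" for v y :: "real ^ 'n"
    by (simp add: diag_def matrix_vector_mult_def if_distrib if_distribR cong: if_cong)
  have "(2 *\<^sub>R diag \<gamma>) *v x = 2 *\<^sub>R (diag \<gamma> *v x)"
    by (simp add: scaleR_matrix_vector_assoc)
  moreover have "(W *v x) $ i = (\<Sum>j\<in>UNIV. W $ i $ j * x $ j)"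
    by (simp add: matrix_vector_mult_def)
  ultimately show ?thesis
    by (simp add: matrix_vector_mult_diff_rdistrib matrix_vector_mult_add_rdistrib
        matrix_vector_mul_assoc [symmetric] diag algebra_simps)
qed

lemma response_pos:
  fixes x :: "real ^ 'n"
  assumes W: "influence_matrix W" and \<gamma>: "\<And>i. 0 \<le> \<gamma> $ i" and b: "\<And>i. \<gamma> $ i < b $ i"
    and z: "(diag (2 *\<^sub>R b) + 2 *\<^sub>R diag \<gamma> - diag \<gamma> ** W) *v x = z"
  shows "(\<And>i. 0 < z $ i) \<Longrightarrow> 0 < x $ i" and "(\<And>i. 0 \<le> z $ i) \<Longrightarrow> 0 \<le> x $ i"
proof -
  obtain m where m: "\<And>i. x $ m \<le> x $ i"
    using finite_imageI [of UNIV "\<lambda>i. x $ i"] Min_in [of "range (\<lambda>i. x $ i)"]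
      Min_le [of "range (\<lambda>i. x $ i)"] by fastforce
  have "x $ m = (\<Sum>j\<in>UNIV. W $ m $ j * x $ m)"
    using W by (simp add: influence_matrix_def sum_distrib_right [symmetric])
  also have "\<dots> \<le> (\<Sum>j\<in>UNIV. W $ m $ j * x $ j)"
    using W m by (intro sum_mono mult_left_mono) (auto simp: influence_matrix_def)
  finally have "\<gamma> $ m * x $ m \<le> \<gamma> $ m * (\<Sum>j\<in>UNIV. W $ m $ j * x $ j)"
    using \<gamma> by (rule mult_left_mono)
  moreover have "z $ m = 2 * (b $ m + \<gamma> $ m) * x $ m - \<gamma> $ m * (\<Sum>j\<in>UNIV. W $ m $ j * x $ j)"
    by (simp add: z [symmetric] response_matrix_nth)
  ultimately have *: "z $ m \<le> (2 * b $ m + \<gamma> $ m) * x $ m"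
    by (simp add: algebra_simps)
  have pos: "0 < 2 * b $ m + \<gamma> $ m"
    using \<gamma> [of m] b [of m] by simp
  show "0 < x $ i" if "\<And>i. 0 < z $ i"
    using that [of m] * pos m [of i] by (smt (verit) zero_less_mult_pos)
  show "0 \<le> x $ i" if "\<And>i. 0 \<le> z $ i"
    using that [of m] * pos m [of i] by (smt (verit) zero_le_mult_iff)
qed

lemma response_matrix_invertible:
  assumes "influence_matrix W" and "\<And>i. 0 \<le> \<gamma> $ i" and "\<And>i. \<gamma> $ i < b $ i"
  shows "invertible (diag (2 *\<^sub>R b) + 2 *\<^sub>R diag \<gamma> - diag \<gamma> ** W)" (is "invertible ?A")
proof -
  have "x = 0" if "?A *v x = 0" for x
  proof -
    have "?A *v (- x) = 0"
      using that by (simp add: vec.neg)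
    then have "0 \<le> x $ i" "0 \<le> (- x) $ i" for i
      using response_pos(2) [OF assms that] response_pos(2) [OF assms, of "- x" 0] by simp_all
    then show ?thesis
      by (simp add: vec_eq_iff order_antisym)
  qed
  then show ?thesis
    by (simp add: invertible_left_inverse matrix_left_invertible_ker)
qed

lemma nash_equilibrium_iff:
  assumes W: "influence_matrix W" and \<gamma>: "\<And>i. 0 \<le> \<gamma> $ i" and b: "\<And>i. \<gamma> $ i < b $ i"
    and p: "\<And>i. p $ i < a $ i"
  shows "nash_equilibrium W a b \<gamma> p x \<longleftrightarrow> x = consumption W a b \<gamma> p"
proof -
  let ?A = "diag (2 *\<^sub>R b) + 2 *\<^sub>R diag \<gamma> - diag \<gamma> ** W"
  define s where "s = a - p - ?A *v x"
  define \<beta> where "\<beta> i = b $ i + \<gamma> $ i" for i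
  have \<beta>: "0 < \<beta> i" for i
    using \<gamma> [of i] b [of i] by (simp add: \<beta>_def)
  have inv: "invertible ?A"
    using W \<gamma> b by (rule response_matrix_invertible)
  have cons: "x = consumption W a b \<gamma> p \<longleftrightarrow> s = 0"
  proof -
    have l: "?A ** matrix_inv ?A = mat 1" and r: "matrix_inv ?A ** ?A = mat 1"
      using inv someI_ex [of "\<lambda>A'. ?A ** A' = mat 1 \<and> A' ** ?A = mat 1"]
      by (simp_all add: invertible_def matrix_inv_def)
    have "?A *v x = a - p" if "x = matrix_inv ?A *v (a - p)"
      unfolding that matrix_vector_mul_assoc l by simp
    moreover have "x = matrix_inv ?A *v (a - p)" if "?A *v x = a - p"
      unfolding that [symmetric] matrix_vector_mul_assoc r by simp
    ultimately show ?thesis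
      unfolding consumption_def s_def by force
  qed
  have s_nth: "s $ i = a $ i - p $ i - (2 * \<beta> i * x $ i - \<gamma> $ i * (\<Sum>j\<in>UNIV. W $ i $ j * x $ j))" for i
    unfolding s_def vector_minus_component response_matrix_nth \<beta>_def ..
  have dev: "utility W a b \<gamma> p i (\<chi> j. if j = i then y else x $ j) - utility W a b \<gamma> p i x =
      (y - x $ i) * s $ i - \<beta> i * (y - x $ i)\<^sup>2" for i y
  proof -
    have "W $ i $ i = 0"
      using W by (simp add: influence_matrix_def)
    then have sum: "(\<Sum>j\<in>UNIV. W $ i $ j * (\<chi> j. if j = i then y else x $ j) $ j)
        = (\<Sum>j\<in>UNIV. W $ i $ j * x $ j)"
      by (intro sum.cong) auto
    show ?thesis
      unfolding utility_def sum s_nth \<beta>_def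
      by (simp add: algebra_simps power2_eq_square)
  qed
  show ?thesis
  proof
    assume nash: "nash_equilibrium W a b \<gamma> p x"
    then have x0: "0 \<le> x $ i" for i
      by (simp add: nash_equilibrium_def)
    have opt: "(y - x $ i) * s $ i \<le> \<beta> i * (y - x $ i)\<^sup>2" if "0 \<le> y" for i y
    proof -
      have "utility W a b \<gamma> p i (\<chi> j. if j = i then y else x $ j) \<le> utility W a b \<gamma> p i x"
        using nash that unfolding nash_equilibrium_def by blast
      with dev [of i y] show ?thesis by linarith
    qed
    have "s $ i = 0" for i
    proof -
      let ?t = "s $ i / (2 * \<beta> i)"
      have step: False if "0 \<le> x $ i + ?t" "s $ i \<noteq> 0"
      proof -
        have "?t * s $ i \<le> \<beta> i * ?t\<^sup>2"
          using opt [of "x $ i + ?t" i, OF that(1)] by (simp only: add_diff_cancel_left')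
        moreover have "?t * s $ i = 2 * (\<beta> i * ?t\<^sup>2)"
          using \<beta> [of i] by (simp add: power2_eq_square field_simps)
        moreover have "0 < \<beta> i * ?t\<^sup>2"
          using \<beta> [of i] that(2) by (intro mult_pos_pos) auto
        ultimately show False by linarith
      qed
      show ?thesis
      proof (cases "s $ i \<ge> 0")
        case True
        then have "0 \<le> x $ i + ?t"
          using x0 [of i] \<beta> [of i] by simp
        with step show ?thesis by blast
      next
        case False
        have "0 \<le> (\<Sum>j\<in>UNIV. W $ i $ j * x $ j)"
          using W x0 by (intro sum_nonneg mult_nonneg_nonneg) (auto simp: influence_matrix_def)
        then have "- (2 * \<beta> i * x $ i) \<le> s $ i"
          using p [of i] mult_nonneg_nonneg [OF \<gamma> [of i]] unfolding s_nth by fastforce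
        then have "0 \<le> x $ i + ?t"
          using \<beta> [of i] by (simp add: field_simps)
        with step False show ?thesis by force
      qed
    qed
    then show "x = consumption W a b \<gamma> p"
      unfolding cons by (simp add: vec_eq_iff)
  next
    assume "x = consumption W a b \<gamma> p"
    then have s0: "s = 0"
      by (simp add: cons)
    then have "?A *v x = a - p"
      by (simp add: s_def)
    then have xpos: "0 < x $ i" for i
      by (rule response_pos(1) [OF W \<gamma> b]) (simp add: p)
    show "nash_equilibrium W a b \<gamma> p x"
    proof -
      have "utility W a b \<gamma> p i (\<chi> j. if j = i then y else x $ j) \<le> utility W a b \<gamma> p i x" for i y
      proof -
        have "0 \<le> \<beta> i * (y - x $ i)\<^sup>2"
          using \<beta> [of i] by simp
        moreover have "(y - x $ i) * s $ i = 0"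
          by (simp add: s0)
        ultimately show ?thesis
          using dev [of i y] by linarith
      qed
      with xpos show ?thesis
        unfolding nash_equilibrium_def by (simp add: less_imp_le)
    qed
  qed
qed

end

theory Submission
  imports Defs
begin

text \<open>
  Substituting \<open>p = a - A x\<close>, with \<open>A = B + 2\<Gamma> - \<Gamma>W\<close>, turns the profit into the quadratic function
  \<open>a \<bullet> x - x \<bullet> (M x)\<close>, because \<open>M\<close> is the symmetric part of \<open>A + C\<close>. If \<open>M\<close> is positive definite, its
  unique maximizer solves \<open>2 M x = a\<close>, which is translated back to prices by \<open>p = a - A x\<close>. Conversely,
  at a maximizer with positive prices every small change of \<open>x\<close> is feasible, and strict optimality in
  the directions \<open>d\<close> and \<open>- d\<close> gives \<open>0 < d \<bullet> (M d)\<close>. At \<open>p_opt\<close> some price may exceed \<open>a $ i\<close>;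
  the equilibrium is nevertheless unique since \<open>M\<close> is an M-matrix, which makes \<open>x_opt\<close> positive.
\<close>

abbreviation response_matrix :: "real ^ 'n ^ 'n \<Rightarrow> real ^ 'n \<Rightarrow> real ^ 'n \<Rightarrow> real ^ 'n ^ 'n" where
  "response_matrix W b \<gamma> \<equiv> diag (2 *\<^sub>R b) + 2 *\<^sub>R diag \<gamma> - diag \<gamma> ** W"

abbreviation profit_matrix ::
    "real ^ 'n ^ 'n \<Rightarrow> real ^ 'n \<Rightarrow> real ^ 'n \<Rightarrow> real ^ 'n \<Rightarrow> real ^ 'n ^ 'n" where
  "profit_matrix W b \<gamma> c \<equiv> 2 *\<^sub>R diag \<gamma> + diag (2 *\<^sub>R b) + diag c
     - ((1/2) *\<^sub>R (transpose W ** diag \<gamma>) + (1/2) *\<^sub>R (diag \<gamma> ** W))"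

section \<open>Diagonal matrices, inverses and quadratic forms\<close>

lemma diag_mult_vector_nth: "(diag v *v y) $ i = v $ i * y $ i"
  by (simp add: diag_def matrix_vector_mult_def if_distrib if_distribR cong: if_cong)

lemma diag_mult_nth: "(diag v ** N) $ i $ j = v $ i * N $ i $ j"
  by (simp add: diag_def matrix_matrix_mult_def if_distrib if_distribR cong: if_cong)

lemma mult_diag_nth: "(N ** diag v) $ i $ j = N $ i $ j * v $ j"
  by (simp add: diag_def matrix_matrix_mult_def if_distrib if_distribR cong: if_cong)

lemma inner_transpose_mult: "x \<bullet> ((transpose N :: real ^ 'n ^ 'n) *v y) = y \<bullet> (N *v x)"
  by (metis dot_lmul_matrix inner_commute transpose_matrix_vector)

lemma matrix_inv_mult_vector_iff:
  fixes A :: "real ^ 'n ^ 'n"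
  assumes "invertible A"
  shows "x = matrix_inv A *v y \<longleftrightarrow> A *v x = y"
proof -
  have "A ** matrix_inv A = mat 1" "matrix_inv A ** A = mat 1"
    using assms someI_ex [of "\<lambda>A'. A ** A' = mat 1 \<and> A' ** A = mat 1"]
    by (simp_all add: invertible_def matrix_inv_def)
  then show ?thesis
    by (metis matrix_vector_mul_assoc matrix_vector_mul_lid)
qed

lemma positive_definite_invertible:
  assumes "positive_definite M"
  shows "invertible M"
proof -
  have "x = 0" if "M *v x = 0" for x
    using assms that unfolding positive_definite_def by (metis inner_zero_right less_irrefl)
  then show ?thesis
    by (simp add: invertible_left_inverse matrix_left_invertible_ker)
qed

text \<open>Symmetry makes the two cross terms \<open>x \<bullet> (M *v d)\<close> and
  \<open>d \<bullet> (M *v x)\<close> equal, so the second-order expansion is exact. Its gradient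
  \<open>a - 2 *\<^sub>R (M *v x)\<close> vanishes at the candidate optimum, and its linear term
  drives the necessity argument.\<close>

lemma quadratic_increment:
  fixes M :: "real ^ 'n ^ 'n"
  assumes "transpose M = M"
  shows "a \<bullet> (x + d) - (x + d) \<bullet> (M *v (x + d))
    = a \<bullet> x - x \<bullet> (M *v x) + (a - 2 *\<^sub>R (M *v x)) \<bullet> d - d \<bullet> (M *v d)"
proof -
  have "x \<bullet> (M *v d) = d \<bullet> (M *v x)"
    using inner_transpose_mult [of x M d] assms by simp
  then show ?thesis
    by (simp add: matrix_vector_right_distrib inner_add_left inner_add_right inner_diff_left
        inner_commute [of "M *v x" d])
qed

text \<open>Split \<open>x\<close> into its positive part \<open>v\<close> and negative part
  \<open>u\<close>. Their supports are disjoint, so only off-diagonal entries of \<open>M\<close>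
  enter \<open>u \<bullet> (M *v v)\<close>, which is therefore \<le> 0; since
  \<open>u \<bullet> (M *v x)\<close> is nonnegative, \<open>u \<bullet> (M *v u)\<close> is \<le> 0
  and definiteness forces \<open>u = 0\<close>. A zero coordinate of the nonnegative
  \<open>x\<close> would then make that coordinate of \<open>M *v x\<close> nonpositive.\<close>

lemma m_matrix_positive_solution:
  fixes M :: "real ^ 'n ^ 'n"
  assumes M: "positive_definite M" and off: "\<And>i j. i \<noteq> j \<Longrightarrow> M $ i $ j \<le> 0"
    and pos: "\<And>i. 0 < (M *v x) $ i"
  shows "0 < x $ i"
proof -
  define u where "u = (\<chi> i. max 0 (- x $ i))"
  define v where "v = (\<chi> i. max 0 (x $ i))"
  have x: "x = v - u"
    by (auto simp: u_def v_def vec_eq_iff)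
  have "u $ i * (M $ i $ j * v $ j) \<le> 0" for i j
  proof (cases "i = j")
    case True
    then show ?thesis by (auto simp: u_def v_def max_def)
  next
    case False
    then show ?thesis
      using off [OF False]
      by (intro mult_nonneg_nonpos mult_nonpos_nonneg) (auto simp: u_def v_def)
  qed
  then have "u \<bullet> (M *v v) \<le> 0"
    by (auto simp: inner_vec_def matrix_vector_mult_def sum_distrib_left intro!: sum_nonpos)
  moreover have "0 \<le> u \<bullet> (M *v x)"
    unfolding inner_vec_def using pos
    by (auto intro!: sum_nonneg mult_nonneg_nonneg simp: u_def less_imp_le)
  ultimately have "u \<bullet> (M *v u) \<le> 0"
    by (simp add: x matrix_vector_mult_diff_distrib inner_diff_right)
  then have "u = 0"
    using M unfolding positive_definite_def by (meson not_less)
  with x have "x = v"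
    by simp
  moreover have "0 \<le> v $ j" for j
    by (simp add: v_def)
  ultimately have nonneg: "0 \<le> x $ j" for j
    by simp
  show ?thesis
  proof (rule ccontr)
    assume "\<not> 0 < x $ i"
    with nonneg [of i] have "x $ i = 0" by simp
    then have "M $ i $ j * x $ j \<le> 0" for j
      using off [of i j] nonneg [of j] by (cases "i = j") (auto intro: mult_nonpos_nonneg)
    then have "(M *v x) $ i \<le> 0"
      by (auto simp: matrix_vector_mult_def intro: sum_nonpos)
    with pos [of i] show False by simp
  qed
qed

section \<open>Profit as a quadratic function of consumption\<close>

lemma consumption_iff:
  assumes "influence_matrix W" and "\<And>i. 0 \<le> \<gamma> $ i" and "\<And>i. \<gamma> $ i < b $ i"
  shows "x = consumption W a b \<gamma> p \<longleftrightarrow> p = a - response_matrix W b \<gamma> *v x"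
  unfolding consumption_def
    matrix_inv_mult_vector_iff [OF response_matrix_invertible [OF assms]]
  by (metis add_diff_cancel_left' diff_add_cancel)

text \<open>Splitting off the response matrix leaves an asymmetric remainder. Once
  \<open>M *v x\<close> equals half of \<open>a\<close>, solving for \<open>a\<close> minus the
  response term yields exactly the summands of the price formula.\<close>

lemma profit_matrix_mult:
  "profit_matrix W b \<gamma> c *v x = response_matrix W b \<gamma> *v x + diag c *v x
     - (1/2) *\<^sub>R (transpose W ** diag \<gamma> *v x) + (1/2) *\<^sub>R (diag \<gamma> ** W *v x)"
proof -
  have "(diag \<gamma> ** W) *v x = (1/2) *\<^sub>R (diag \<gamma> ** W *v x) + (1/2) *\<^sub>R (diag \<gamma> ** W *v x)"
    by (simp add: scaleR_left_distrib [symmetric])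
  then show ?thesis
    by (simp add: matrix_vector_mult_add_rdistrib matrix_vector_mult_diff_rdistrib
        scaleR_matrix_vector_assoc [symmetric])
qed

lemma transpose_diag: "transpose (diag v) = diag v"
  by (auto simp: diag_def transpose_def vec_eq_iff)

lemma transpose_profit_matrix: "transpose (profit_matrix W b \<gamma> c) = profit_matrix W b \<gamma> c"
  by (auto simp: transpose_def vec_eq_iff diag_mult_nth mult_diag_nth) (auto simp: diag_def mult.commute)

lemma profit_matrix_off_diagonal:
  assumes "influence_matrix W" and "\<And>i. 0 \<le> \<gamma> $ i" and "i \<noteq> j"
  shows "profit_matrix W b \<gamma> c $ i $ j \<le> 0"
  using assms
  by (simp add: diag_mult_nth mult_diag_nth transpose_def influence_matrix_def)
     (simp add: diag_def)

text \<open>\<open>transpose W ** diag \<gamma>\<close> is the transpose of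
  \<open>diag \<gamma> ** W\<close>, so both have the same quadratic form and the two half terms of
  \<open>profit_matrix_mult\<close> cancel.\<close>

lemma profit_eq_quadratic:
  assumes "influence_matrix W" and "\<And>i. 0 \<le> \<gamma> $ i" and "\<And>i. \<gamma> $ i < b $ i"
    and x: "x = consumption W a b \<gamma> p"
  shows "profit W a b \<gamma> c p = a \<bullet> x - x \<bullet> (profit_matrix W b \<gamma> c *v x)"
proof -
  have "x \<bullet> (transpose W ** diag \<gamma> *v x) = x \<bullet> (diag \<gamma> ** W *v x)"
    using inner_transpose_mult [of x "diag \<gamma> ** W" x]
    by (simp add: matrix_transpose_mul transpose_diag)
  then have "x \<bullet> (profit_matrix W b \<gamma> c *v x)
      = x \<bullet> (response_matrix W b \<gamma> *v x) + x \<bullet> (diag c *v x)"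
    unfolding profit_matrix_mult by (simp add: inner_add_right inner_diff_right)
  moreover have "x \<bullet> (diag c *v x) = (\<Sum>i\<in>UNIV. c $ i * (x $ i)\<^sup>2)"
    by (simp add: inner_vec_def diag_mult_vector_nth power2_eq_square algebra_simps)
  moreover have "p \<bullet> x = a \<bullet> x - x \<bullet> (response_matrix W b \<gamma> *v x)"
    using x unfolding consumption_iff [OF assms(1-3)] by (simp add: inner_diff_left inner_diff_right inner_commute [of _ x])
  moreover have "profit W a b \<gamma> c p = p \<bullet> x - (\<Sum>i\<in>UNIV. c $ i * (x $ i)\<^sup>2)"
    by (simp add: profit_def x [symmetric] inner_vec_def sum_subtractf)
  ultimately show ?thesis by simp
qed

text \<open>
  At an equilibrium every marginal utility \<open>s x $ i\<close> is nonpositive, so monotonicity of the response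
  gives \<open>x \<ge> consumption W a b \<gamma> p\<close>. Hence \<open>x\<close> is positive and the first-order conditions are equalities.
\<close>

lemma nash_equilibrium_iff_of_pos:
  assumes W: "influence_matrix W" and \<gamma>: "\<And>i. 0 \<le> \<gamma> $ i" and b: "\<And>i. \<gamma> $ i < b $ i"
    and pos: "\<And>i. 0 < consumption W a b \<gamma> p $ i"
  shows "nash_equilibrium W a b \<gamma> p x \<longleftrightarrow> x = consumption W a b \<gamma> p"
proof -
  define s where "s y = a - p - response_matrix W b \<gamma> *v y" for y
  define \<beta> where "\<beta> i = b $ i + \<gamma> $ i" for i
  have \<beta>: "0 < \<beta> i" for i
    using \<gamma> [of i] b [of i] by (simp add: \<beta>_def)
  have cons: "y = consumption W a b \<gamma> p \<longleftrightarrow> s y = 0" for y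
    unfolding consumption_iff [OF W \<gamma> b] s_def by (auto simp: algebra_simps)
  \<comment> \<open>In the user's own consumption, utility is a concave parabola with slope
    \<open>s x $ i\<close> at the current point and leading coefficient \<open>- \<beta> i\<close>.
    The zero diagonal of \<open>W\<close> keeps the neighbour sum unaffected by the
    deviation.\<close>
  have dev: "utility W a b \<gamma> p i (\<chi> j. if j = i then y else x $ j) - utility W a b \<gamma> p i x =
      (y - x $ i) * s x $ i - \<beta> i * (y - x $ i)\<^sup>2" for i y x
  proof -
    have "W $ i $ i = 0"
      using W by (simp add: influence_matrix_def)
    then have sum: "(\<Sum>j\<in>UNIV. W $ i $ j * (\<chi> j. if j = i then y else x $ j) $ j)
        = (\<Sum>j\<in>UNIV. W $ i $ j * x $ j)"
      by (intro sum.cong) auto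
    show ?thesis
      unfolding utility_def sum s_def vector_minus_component response_matrix_nth \<beta>_def
      by (simp add: algebra_simps power2_eq_square)
  qed
  show ?thesis
  proof
    assume nash: "nash_equilibrium W a b \<gamma> p x"
    have opt: "(y - x $ i) * s x $ i \<le> \<beta> i * (y - x $ i)\<^sup>2" if "0 \<le> y" for i y
    proof -
      have "utility W a b \<gamma> p i (\<chi> j. if j = i then y else x $ j) \<le> utility W a b \<gamma> p i x"
        using nash that unfolding nash_equilibrium_def by blast
      with dev [of i y x] show ?thesis by linarith
    qed
    \<comment> \<open>The tested deviation is the vertex of this parabola: if it is feasible and the
      slope is nonzero, moving there is a strict gain.\<close>
    have step: "s x $ i = 0" if "0 \<le> x $ i + s x $ i / (2 * \<beta> i)" for i
    proof (rule ccontr)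
      let ?t = "s x $ i / (2 * \<beta> i)"
      assume "s x $ i \<noteq> 0"
      then have "0 < \<beta> i * ?t\<^sup>2"
        using \<beta> [of i] by (intro mult_pos_pos) auto
      moreover have "?t * s x $ i \<le> \<beta> i * ?t\<^sup>2"
        using opt [of "x $ i + ?t" i, OF that] by (simp only: add_diff_cancel_left')
      moreover have "?t * s x $ i = 2 * (\<beta> i * ?t\<^sup>2)"
        using \<beta> [of i] by (simp add: power2_eq_square field_simps)
      ultimately show False by linarith
    qed
    have x0: "0 \<le> x $ i" for i
      using nash by (simp add: nash_equilibrium_def)
    have s_nonpos: "s x $ i \<le> 0" for i
    proof (rule ccontr)
      assume "\<not> s x $ i \<le> 0"
      with step [of i] x0 [of i] \<beta> [of i] show False by simp
    qed
    let ?e = "consumption W a b \<gamma> p"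
    have "s ?e = 0"
      using cons by blast
    then have "response_matrix W b \<gamma> *v (x - ?e) = - s x"
      by (simp add: s_def algebra_simps)
    then have "0 \<le> (x - ?e) $ i" for i
      by (rule response_pos(2) [OF W \<gamma> b]) (simp add: s_nonpos)
    then have xpos: "0 < x $ i" for i
      using pos [of i] by (simp add: order_less_le_trans)
    have "s x $ i = 0" for i
    proof (rule ccontr)
      assume "s x $ i \<noteq> 0"
      with s_nonpos [of i] have neg: "s x $ i < 0" by simp
      \<comment> \<open>The step down to the vertex, truncated so that consumption stays
        nonnegative. Being at most the full step, it loses at most half of the linear gain to the
        quadratic term.\<close>
      define t where "t = min (x $ i) (- (s x $ i) / (2 * \<beta> i))"
      have t: "0 < t" "t \<le> x $ i" "2 * (\<beta> i * t) \<le> - (s x $ i)"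
        using xpos [of i] neg \<beta> [of i] by (auto simp: t_def min_def field_simps)
      have "t * (- (s x $ i)) \<le> t * (\<beta> i * t)"
        using opt [of "x $ i - t" i] t by (simp add: power2_eq_square algebra_simps)
      with t(1) have "- (s x $ i) \<le> \<beta> i * t"
        by (simp only: mult_le_cancel_left_pos)
      moreover have "0 < \<beta> i * t"
        using t(1) \<beta> by simp
      ultimately show False using t(3) by linarith
    qed
    then show "x = ?e"
      unfolding cons by (simp add: vec_eq_iff)
  next
    assume x: "x = consumption W a b \<gamma> p"
    have "utility W a b \<gamma> p i (\<chi> j. if j = i then y else x $ j) \<le> utility W a b \<gamma> p i x" for i y
    proof -
      have "0 \<le> \<beta> i * (y - x $ i)\<^sup>2"
        using \<beta> [of i] by simp
      moreover have "(y - x $ i) * s x $ i = 0"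
        using x unfolding cons by simp
      ultimately show ?thesis
        using dev [of i y x] by linarith
    qed
    with pos show "nash_equilibrium W a b \<gamma> p x"
      unfolding nash_equilibrium_def x by (simp add: less_imp_le)
  qed
qed

section \<open>Unique maximizers and feasible perturbations\<close>

lemma optimal_price_iff:
  "optimal_price W a b \<gamma> c p \<longleftrightarrow> (\<forall>i. 0 \<le> p $ i) \<and>
     (\<forall>q. (\<forall>i. 0 \<le> q $ i) \<and> q \<noteq> p \<longrightarrow> profit W a b \<gamma> c q < profit W a b \<gamma> c p)"
  (is "?L \<longleftrightarrow> ?R")
proof
  assume L: ?L
  then have "is_arg_max (profit W a b \<gamma> c) (\<lambda>q. \<forall>i. 0 \<le> q $ i) p"
    and uniq: "\<And>q. is_arg_max (profit W a b \<gamma> c) (\<lambda>q. \<forall>i. 0 \<le> q $ i) q \<Longrightarrow> q = p"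
    by (auto simp: optimal_price_def)
  \<comment> \<open>A feasible price that ties with the maximizer would itself be a maximizer, so
    uniqueness makes the comparison strict.\<close>
  then show ?R
    unfolding is_arg_max_linorder by (meson le_less_linear order_trans)
next
  assume ?R
  then show ?L
    unfolding optimal_price_def is_arg_max_linorder by (fastforce simp: not_less [symmetric])
qed

text \<open>Finitely many coordinates stay positive by continuity. The filter \<open>at 0\<close>
  admits both signs of \<open>t\<close>, so a positive price can be perturbed either way along any
  line.\<close>

lemma eventually_nonneg_along_line:
  fixes p v :: "real ^ 'n"
  assumes "\<And>i. 0 < p $ i"
  shows "\<forall>\<^sub>F t in at 0. \<forall>i. 0 \<le> (p + t *\<^sub>R v) $ i"
proof -
  have "\<forall>\<^sub>F t in at 0. 0 < (p + t *\<^sub>R v) $ i" for i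
  proof (rule order_tendstoD(1))
    show "((\<lambda>t. (p + t *\<^sub>R v) $ i) \<longlongrightarrow> (p + 0 *\<^sub>R v) $ i) (at 0)"
      by (intro tendsto_intros)
    show "0 < (p + 0 *\<^sub>R v) $ i"
      using assms by simp
  qed
  then have "\<forall>\<^sub>F t in at 0. \<forall>i. 0 < (p + t *\<^sub>R v) $ i"
    by (simp add: eventually_all_finite)
  then show ?thesis
    by (rule eventually_mono) (simp add: less_imp_le)
qed

theorem theorem2:
  fixes W :: "real ^ 'n ^ 'n" and a b \<gamma> c :: "real ^ 'n"
  assumes "influence_matrix W"
    and "\<And>i. 0 < a $ i" and "\<And>i. 0 \<le> \<gamma> $ i" and "\<And>i. \<gamma> $ i < b $ i" and "\<And>i. 0 \<le> c $ i"
  shows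
    "let B = diag (2 *\<^sub>R b); \<Gamma> = diag \<gamma>; C = diag c;
         M = 2 *\<^sub>R \<Gamma> + B + C - ((1/2) *\<^sub>R (transpose W ** \<Gamma>) + (1/2) *\<^sub>R (\<Gamma> ** W));
         Z = matrix_inv M;
         p_opt = (1/2) *\<^sub>R a + (C ** Z) *v ((1/2) *\<^sub>R a)
                 - (transpose W ** \<Gamma> ** Z) *v ((1/4) *\<^sub>R a) + (\<Gamma> ** W ** Z) *v ((1/4) *\<^sub>R a);
         x_opt = matrix_inv (C + B + 2 *\<^sub>R \<Gamma> - (1/2) *\<^sub>R (transpose W ** \<Gamma>) - (1/2) *\<^sub>R (\<Gamma> ** W))
                 *v ((1/2) *\<^sub>R a)
     in
       (positive_definite M \<and> (\<forall>i. 0 \<le> p_opt $ i) \<longrightarrow>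
          optimal_price W a b \<gamma> c p_opt \<and>
          consumption W a b \<gamma> p_opt = x_opt \<and>
          (\<forall>x. nash_equilibrium W a b \<gamma> p_opt x \<longleftrightarrow> x = x_opt) \<and>
          (transpose W = W \<longrightarrow>
             profit W a b \<gamma> c p_opt = (1/4) * (a \<bullet> (Z *v a)) \<and>
             (\<Gamma> ** W = W ** \<Gamma> \<longrightarrow>
                profit W a b \<gamma> c p_opt
                  = (1/4) * (a \<bullet> (matrix_inv (C + B + 2 *\<^sub>R \<Gamma> - \<Gamma> ** W) *v a))))) \<and>
       (\<forall>p. optimal_price W a b \<gamma> c p \<and> (\<forall>i. 0 < p $ i) \<longrightarrow> positive_definite M \<and> p = p_opt)"
proof -
  define M where "M = profit_matrix W b \<gamma> c"
  define Z where "Z = matrix_inv M"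
  define x_opt where "x_opt = Z *v ((1/2) *\<^sub>R a)"
  define p_opt where "p_opt = (1/2) *\<^sub>R a + (diag c ** Z) *v ((1/2) *\<^sub>R a)
      - (transpose W ** diag \<gamma> ** Z) *v ((1/4) *\<^sub>R a) + (diag \<gamma> ** W ** Z) *v ((1/4) *\<^sub>R a)"
  let ?A = "response_matrix W b \<gamma>"
  let ?x = "consumption W a b \<gamma>"
  let ?f = "\<lambda>x. a \<bullet> x - x \<bullet> (M *v x)"
  note hyps = assms(1,3,4)
  have M_eq: "diag c + diag (2 *\<^sub>R b) + 2 *\<^sub>R diag \<gamma> - (1/2) *\<^sub>R (transpose W ** diag \<gamma>)
      - (1/2) *\<^sub>R (diag \<gamma> ** W) = M"
    by (simp add: M_def algebra_simps)
  \<comment> \<open>Symmetry of \<open>W\<close> only turns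
    \<open>transpose W ** diag \<gamma>\<close> into \<open>W ** diag \<gamma>\<close>; commutation
    is what lets the two halves merge into \<open>diag \<gamma> ** W\<close>.\<close>
  have M_eq_sym: "diag c + diag (2 *\<^sub>R b) + 2 *\<^sub>R diag \<gamma> - diag \<gamma> ** W = M"
    if "transpose W = W" "diag \<gamma> ** W = W ** diag \<gamma>"
  proof -
    have "diag \<gamma> ** W = (1/2) *\<^sub>R (diag \<gamma> ** W) + (1/2) *\<^sub>R (diag \<gamma> ** W)"
      by (simp add: scaleR_left_distrib [symmetric])
    then show ?thesis
      unfolding M_def that(1) that(2) [symmetric] by (simp add: algebra_simps)
  qed
  have symM: "transpose M = M"
    unfolding M_def by (rule transpose_profit_matrix)
  have profit: "profit W a b \<gamma> c p = ?f (?x p)" for p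
    unfolding M_def using hyps refl by (rule profit_eq_quadratic)
  have price: "x = ?x p \<longleftrightarrow> p = a - ?A *v x" for x p
    using hyps by (rule consumption_iff)
  have M_opt: "x = x_opt \<longleftrightarrow> 2 *\<^sub>R (M *v x) = a" if "positive_definite M" for x
  proof -
    have "x = x_opt \<longleftrightarrow> M *v x = (1/2) *\<^sub>R a"
      unfolding x_opt_def Z_def
      by (rule matrix_inv_mult_vector_iff [OF positive_definite_invertible [OF that]])
    also have "\<dots> \<longleftrightarrow> 2 *\<^sub>R (M *v x) = a"
      by (auto simp: vec_eq_iff mult.commute)
    finally show ?thesis .
  qed
  have x_p_opt: "?x p_opt = x_opt" if "positive_definite M"
  proof -
    \<comment> \<open>Writing a quarter of \<open>a\<close> as half of its half exposes
      \<open>x_opt\<close> in every summand of \<open>p_opt\<close>; the response term is then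
      eliminated through \<open>M *v x_opt\<close>.\<close>
    have "(1/4) *\<^sub>R a = (1/2) *\<^sub>R ((1/2) *\<^sub>R a)"
      by simp
    then have p_opt: "p_opt = (1/2) *\<^sub>R a + diag c *v x_opt
        - (1/2) *\<^sub>R (transpose W ** diag \<gamma> *v x_opt) + (1/2) *\<^sub>R (diag \<gamma> ** W *v x_opt)"
      by (simp only: p_opt_def x_opt_def matrix_vector_mul_assoc matrix_vector_mult_scaleR)
    have half: "M *v x_opt = (1/2) *\<^sub>R a"
      using M_opt [OF that, of x_opt] by (auto simp: vec_eq_iff mult.commute)
    have M: "M *v x_opt = ?A *v x_opt + diag c *v x_opt
        - (1/2) *\<^sub>R (transpose W ** diag \<gamma> *v x_opt) + (1/2) *\<^sub>R (diag \<gamma> ** W *v x_opt)"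
      unfolding M_def by (rule profit_matrix_mult)
    have "p_opt $ i = (a - ?A *v x_opt) $ i" for i
      using arg_cong [OF half, of "\<lambda>v. v $ i"] arg_cong [OF M, of "\<lambda>v. v $ i"]
        arg_cong [OF p_opt, of "\<lambda>v. v $ i"]
      by (simp only: vector_add_component vector_minus_component vector_scaleR_component
          real_scaleR_def)
    then have "p_opt = a - ?A *v x_opt"
      by (simp only: vec_eq_iff) blast
    then show ?thesis
      using price by metis
  qed

  \<comment> \<open>Sufficiency: definiteness and nonnegative prices give the optimum\<close>
  have sufficient: "optimal_price W a b \<gamma> c p_opt \<and> ?x p_opt = x_opt \<and>
      (\<forall>x. nash_equilibrium W a b \<gamma> p_opt x \<longleftrightarrow> x = x_opt) \<and>
      profit W a b \<gamma> c p_opt = (1/4) * (a \<bullet> (Z *v a))"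
    if pd: "positive_definite M" and nonneg: "\<forall>i. 0 \<le> p_opt $ i"
  proof -
    have a: "2 *\<^sub>R (M *v x_opt) = a"
      using M_opt [OF pd] by blast
    have "profit W a b \<gamma> c q < profit W a b \<gamma> c p_opt" if "q \<noteq> p_opt" for q
    proof -
      \<comment> \<open>The response to prices is injective, so a different price gives a nonzero
        increment, and the quadratic term is a strict loss.\<close>
      have "?x q \<noteq> x_opt"
        using that x_p_opt [OF pd] price by metis
      then have "0 < (?x q - x_opt) \<bullet> (M *v (?x q - x_opt))"
        using pd by (simp add: positive_definite_def)
      then show ?thesis
        using quadratic_increment [OF symM, of a x_opt "?x q - x_opt"]
        by (simp add: profit x_p_opt [OF pd] a)
    qed
    then have "optimal_price W a b \<gamma> c p_opt"
      using nonneg by (simp add: optimal_price_iff)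
    moreover have "0 < x_opt $ i" for i
    proof (rule m_matrix_positive_solution [OF pd])
      show "M $ i $ j \<le> 0" if "i \<noteq> j" for i j
        unfolding M_def using assms(1,3) that by (rule profit_matrix_off_diagonal)
      have "2 * (M *v x_opt) $ i = a $ i" for i
        using a by (metis vector_scaleR_component real_scaleR_def)
      then show "0 < (M *v x_opt) $ i" for i
        using assms(2) [of i] by (metis zero_less_mult_pos zero_less_numeral)
    qed
    then have "nash_equilibrium W a b \<gamma> p_opt x \<longleftrightarrow> x = x_opt" for x
      using nash_equilibrium_iff_of_pos [OF hyps, of a p_opt x] x_p_opt [OF pd] by simp
    moreover have "profit W a b \<gamma> c p_opt = (1/4) * (a \<bullet> (Z *v a))"
    proof -
      \<comment> \<open>Stationarity makes the quadratic term half of the linear one, leaving half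
        of \<open>a \<bullet> x_opt\<close> as profit.\<close>
      have "2 * (x_opt \<bullet> (M *v x_opt)) = a \<bullet> x_opt"
        using a by (metis inner_commute inner_scaleR_right)
      moreover have "a \<bullet> x_opt = (1/2) * (a \<bullet> (Z *v a))"
        by (simp add: x_opt_def matrix_vector_mult_scaleR)
      ultimately show ?thesis
        by (simp add: profit x_p_opt [OF pd])
    qed
    ultimately show ?thesis
      using x_p_opt [OF pd] by blast
  qed

  \<comment> \<open>Necessity: a positive optimal price forces definiteness and the formula\<close>
  have necessary: "positive_definite M \<and> p = p_opt"
    if opt: "optimal_price W a b \<gamma> c p" and pos: "\<And>i. 0 < p $ i" for p
  proof -
    let ?y = "?x p"
    \<comment> \<open>Moving consumption by \<open>t *\<^sub>R d\<close> amounts to moving the price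
      by \<open>t *\<^sub>R (- (?A *v d))\<close>, which is feasible for small
      \<open>t\<close>.\<close>
    have move: "\<forall>\<^sub>F t in at 0. t * ((a - 2 *\<^sub>R (M *v ?y)) \<bullet> d) < t\<^sup>2 * (d \<bullet> (M *v d))"
      if "d \<noteq> 0" for d
    proof -
      have p: "p = a - ?A *v ?y"
        using price by blast
      have "\<forall>\<^sub>F t in at 0. \<forall>i. 0 \<le> (p + t *\<^sub>R (- (?A *v d))) $ i"
        using pos by (rule eventually_nonneg_along_line)
      moreover have "\<forall>\<^sub>F t in at (0::real). t \<noteq> 0"
        by (simp add: eventually_at_filter)
      ultimately show ?thesis
      proof eventually_elim
        case (elim t)
        let ?q = "p + t *\<^sub>R (- (?A *v d))"
        have q: "?x ?q = ?y + t *\<^sub>R d"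
        proof -
          have "?q = a - ?A *v (?y + t *\<^sub>R d)"
            by (subst p) (simp add: matrix_vector_right_distrib matrix_vector_mult_scaleR)
          then show ?thesis using price by metis
        qed
        moreover have "?q \<noteq> p"
          using q elim(2) that by auto
        ultimately have "?f (?y + t *\<^sub>R d) < ?f ?y"
          using opt elim(1) unfolding optimal_price_iff profit by metis
        then show ?case
          using quadratic_increment [OF symM, of a ?y "t *\<^sub>R d"]
          by (simp add: matrix_vector_mult_scaleR power2_eq_square)
      qed
    qed
    have pd: "positive_definite M"
      unfolding positive_definite_def
    proof (intro conjI allI impI symM)
      fix d :: "real ^ 'n"
      assume d: "d \<noteq> 0"
      then have "- d \<noteq> 0"
        by simp
      \<comment> \<open>The linear terms for \<open>d\<close> and \<open>- d\<close> are opposite,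
        so adding the two inequalities leaves only the quadratic form.\<close>
      from move [OF d] move [OF this]
      have "\<forall>\<^sub>F t in at (0::real). 0 < t\<^sup>2 * (d \<bullet> (M *v d))"
        by eventually_elim (simp add: vec.neg)
      then obtain t :: real where "0 < t\<^sup>2 * (d \<bullet> (M *v d))"
        using eventually_happens' [OF at_neq_bot] by blast
      then show "0 < d \<bullet> (M *v d)"
        by (simp add: zero_less_mult_iff)
    qed
    moreover have "?y = x_opt"
    proof (rule ccontr)
      assume "?y \<noteq> x_opt"
      define d where "d = x_opt - ?y"
      have d: "d \<noteq> 0"
        using \<open>?y \<noteq> x_opt\<close> by (simp add: d_def)
      \<comment> \<open>Since the gradient vanishes at \<open>x_opt\<close>, at \<open>?y\<close> it
        is twice \<open>M\<close> applied to the direction towards \<open>x_opt\<close>.\<close>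
      have "a - 2 *\<^sub>R (M *v ?y) = 2 *\<^sub>R (M *v d)"
        using M_opt [OF pd, of x_opt]
        by (simp add: d_def matrix_vector_mult_diff_distrib scaleR_diff_right)
      with move [OF d] have ev: "\<forall>\<^sub>F t in at 0. t * (2 * (d \<bullet> (M *v d))) < t\<^sup>2 * (d \<bullet> (M *v d))"
        by (simp add: inner_commute)
      \<comment> \<open>For \<open>t\<close> between 0 and 1 the linear gain, of factor
        \<open>2 * t\<close>, exceeds the quadratic loss, of factor \<open>t * t\<close>,
        contradicting \<open>move\<close>.\<close>
      have "\<forall>\<^sub>F t in at_right (0::real). t < 1"
        by (rule order_tendstoD(2) [OF tendsto_ident_at]) simp
      moreover have "\<forall>\<^sub>F t in at_right (0::real). 0 < t"
        by (simp add: eventually_at_filter)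
      moreover have "\<forall>\<^sub>F t in at_right 0. t * (2 * (d \<bullet> (M *v d))) < t\<^sup>2 * (d \<bullet> (M *v d))"
        using ev by (simp add: eventually_at_split)
      ultimately have "\<forall>\<^sub>F t in at_right (0::real). False"
      proof eventually_elim
        case (elim t)
        have "0 < d \<bullet> (M *v d)"
          using pd d by (simp add: positive_definite_def)
        then have "t * 2 < t\<^sup>2"
          using elim(3) by (simp add: mult.assoc [symmetric])
        then have "t * 2 < t * t"
          by (simp add: power2_eq_square)
        with elim show ?case
          by simp
      qed
      then show False
        by simp
    qed
    ultimately show ?thesis
      using x_p_opt price by metis
  qed
  show ?thesis
    unfolding Let_def M_eq M_def [symmetric] Z_def [symmetric] p_opt_def [symmetric]
      x_opt_def [symmetric]
    using sufficient necessary M_eq_sym Z_def by auto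
qed

end
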